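(* Let $F$ be a field of characteristic $2$, let $\phi$ be an anisotropic quasilinear quadratic form of dimension $\ge2$ over $F$, and let $s$ be the smallest nonnegative integer with $2^s\ge i_1(\phi)$. Then the first higher anisotropic kernel $\phi_1$ (a form over $F_1=F(\phi)$) is divisible by an $s$-fold quasi-Pfister form over $F_1$.
   Context: Let $F$ be a field of characteristic $2$. A quasilinear quadratic form over a field $K$ of characteristic 2 is a map $\phi\colon V\to K$ on a nonzero finite-dimensional $K$-vector space, homogeneous of degree 2 and additive; equivalently $\phi\simeq\langle a_1,\dots,a_n\rangle\colon(\lambda_i)\mapsto\sum a_i\lambda_i^2$ (these are the totally singular quadratic forms). Tensor product: $(\phi\otimes\psi)(v\otimes w)=\phi(v)\psi(w)$; $\phi$ is divisible by $\psi$ if $\phi\simeq\psi\otimes\tau$ for some form $\tau$. The isotropy index $i_0(\phi)$ is the dimension of the subspace of vectors with $\phi(v)=0$; $\phi$ is anisotropic if $i_0(\phi)=0$; $\phi_{an}$ is the unique anisotropic form with the same value set $D(\phi)$. For non-split $\phi$ (i.e. $\dim\phi_{an}\ge 2$), $K(\phi)$ is the function field of the integral quadric $\{\phi=0\}$. For anisotropic $\phi$ of dimension $\ge 2$: $F_1=F(\phi)$, $\phi_1=(\phi_{F_1})_{an}$ and $i_1(\phi)=i_0(\phi_{F_1})$. An $s$-fold quasi-Pfister form is $\langle\langle a_1,\dots,a_s\rangle\rangle=\bigotimes_{i=1}^s\langle1,a_i\rangle$ ($0$-fold: $\langle1\rangle$). *)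

theory Defs
  imports Main "HOL-Library.Poly_Mapping"
begin

text \<open>A quasilinear form \<open>\<langle>a_0,\<dots>,a_{n-1}\<rangle>\<close> over a field K is represented by the list of its
  coefficients; its dimension is the length of the list. Vectors of K^n are functions
  \<open>nat \<Rightarrow> K\<close> vanishing outside \<open>{..<n}\<close>.\<close>

definition vec_space :: "nat \<Rightarrow> (nat \<Rightarrow> 'b::zero) set" where
  "vec_space n = {v. \<forall>i\<ge>n. v i = 0}"

definition qf_val :: "'b::comm_ring_1 list \<Rightarrow> (nat \<Rightarrow> 'b) \<Rightarrow> 'b" where
  "qf_val a v = (\<Sum>i<length a. a ! i * (v i)^2)"

definition value_set :: "'b::comm_ring_1 list \<Rightarrow> 'b set" where
  "value_set a = qf_val a ` vec_space (length a)"

definition anisotropic :: "'b::comm_ring_1 list \<Rightarrow> bool" where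
  "anisotropic a \<longleftrightarrow> (\<forall>v\<in>vec_space (length a). qf_val a v = 0 \<longrightarrow> v = (\<lambda>_. 0))"

definition lin_indep :: "(nat \<Rightarrow> 'b::field) set \<Rightarrow> bool" where
  "lin_indep B \<longleftrightarrow> finite B \<and>
     (\<forall>c. (\<forall>i. (\<Sum>w\<in>B. c w * w i) = 0) \<longrightarrow> (\<forall>w\<in>B. c w = 0))"

definition subspace_dim :: "(nat \<Rightarrow> 'b::field) set \<Rightarrow> nat" where
  "subspace_dim S = Max {card B | B. B \<subseteq> S \<and> lin_indep B}"

definition isotropy_index :: "'b::field list \<Rightarrow> nat" where
  "isotropy_index a = subspace_dim {v \<in> vec_space (length a). qf_val a v = 0}"

definition mat_app :: "(nat \<Rightarrow> nat \<Rightarrow> 'b::comm_ring_1) \<Rightarrow> nat \<Rightarrow> (nat \<Rightarrow> 'b) \<Rightarrow> nat \<Rightarrow> 'b" where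
  "mat_app M n v = (\<lambda>i. if i < n then (\<Sum>j<n. M i j * v j) else 0)"

definition isometric :: "'b::comm_ring_1 list \<Rightarrow> 'b list \<Rightarrow> bool" where
  "isometric a b \<longleftrightarrow> length a = length b \<and>
     (\<exists>M. bij_betw (mat_app M (length a)) (vec_space (length a)) (vec_space (length a)) \<and>
          (\<forall>v\<in>vec_space (length a). qf_val b (mat_app M (length a) v) = qf_val a v))"

definition qf_tensor :: "'b::comm_ring_1 list \<Rightarrow> 'b list \<Rightarrow> 'b list" where
  "qf_tensor a b = concat (map (\<lambda>x. map (\<lambda>y. x * y) b) a)"

definition quasi_pfister :: "'b::comm_ring_1 list \<Rightarrow> 'b list" where
  "quasi_pfister xs = foldr (\<lambda>x p. qf_tensor [1, x] p) xs [1]"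

definition is_quasi_pfister :: "nat \<Rightarrow> 'b::comm_ring_1 list \<Rightarrow> bool" where
  "is_quasi_pfister s p \<longleftrightarrow> (\<exists>xs. length xs = s \<and> (\<forall>x\<in>set xs. x \<noteq> 0) \<and> p = quasi_pfister xs)"

definition divisible_by :: "'b::comm_ring_1 list \<Rightarrow> 'b list \<Rightarrow> bool" where
  "divisible_by phi psi \<longleftrightarrow> (\<exists>tau. tau \<noteq> [] \<and> isometric phi (qf_tensor psi tau))"

text \<open>Multivariate polynomials over F: \<open>(nat \<Rightarrow>\<^sub>0 nat) \<Rightarrow>\<^sub>0 F\<close> (monomial exponent vector \<mapsto> coefficient).\<close>

definition mpoly_eval :: "('a::comm_ring_1 \<Rightarrow> 'b::comm_ring_1) \<Rightarrow> (nat \<Rightarrow> 'b) \<Rightarrow> ((nat \<Rightarrow>\<^sub>0 nat) \<Rightarrow>\<^sub>0 'a) \<Rightarrow> 'b" where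
  "mpoly_eval \<iota> x p = (\<Sum>m\<in>Poly_Mapping.keys p. \<iota> (Poly_Mapping.lookup p m) * (\<Prod>i\<in>Poly_Mapping.keys m. x i ^ Poly_Mapping.lookup m i))"

definition poly_in_vars :: "nat \<Rightarrow> ((nat \<Rightarrow>\<^sub>0 nat) \<Rightarrow>\<^sub>0 'a::zero) \<Rightarrow> bool" where
  "poly_in_vars n p \<longleftrightarrow> (\<forall>m\<in>Poly_Mapping.keys p. Poly_Mapping.keys m \<subseteq> {..<n})"

definition qf_poly :: "'a::comm_ring_1 list \<Rightarrow> (nat \<Rightarrow>\<^sub>0 nat) \<Rightarrow>\<^sub>0 'a" where
  "qf_poly a = (\<Sum>i<length a. Poly_Mapping.single (Poly_Mapping.single i 2) (a ! i))"

text \<open>\<open>(K, \<iota>, x)\<close> is a model of the function field F(phi) = Frac(F[X_0..X_{n-1}]/(phi)):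
  \<iota> : F \<rightarrow> K is a ring homomorphism, x = (x_0,\<dots>,x_{n-1}) is a point of the quadric over K,
  the kernel of evaluation at x on F[X_0..X_{n-1}] is exactly the ideal (phi), and K is
  generated as a field by \<iota>(F) and the x_i.\<close>
definition is_function_field :: "'a::field list \<Rightarrow> ('a \<Rightarrow> 'b::field) \<Rightarrow> (nat \<Rightarrow> 'b) \<Rightarrow> bool" where
  "is_function_field a \<iota> x \<longleftrightarrow>
     (\<forall>u v. \<iota> (u + v) = \<iota> u + \<iota> v \<and> \<iota> (u * v) = \<iota> u * \<iota> v) \<and> \<iota> 1 = 1 \<and>
     x \<in> vec_space (length a) \<and>
     qf_val (map \<iota> a) x = 0 \<and>
     (\<forall>p. poly_in_vars (length a) p \<and> mpoly_eval \<iota> x p = 0 \<longrightarrow> qf_poly a dvd p) \<and>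
     (\<forall>z. \<exists>p q. poly_in_vars (length a) p \<and> poly_in_vars (length a) q \<and>
          mpoly_eval \<iota> x q \<noteq> 0 \<and> z = mpoly_eval \<iota> x p / mpoly_eval \<iota> x q)"

end

theory Submission
  imports Defs "HOL-Computational_Algebra.Polynomial"
begin

text \<open>
  Let \<open>V \<subseteq> K = F(\<phi>)\<close> be the value set of \<open>\<phi>\<^sub>K\<close>, a vector space over \<open>K\<^sup>2\<close>, and let \<open>x\<close> be the
  generic point. An isotropic vector \<open>y\<close> over \<open>K\<close> is, up to scaling, \<open>Y(x)\<close> for polynomials
  \<open>Y\<^sub>i\<close> with \<open>\<phi>(Y) = \<phi> Q\<close>. Substituting \<open>x\<^sub>j + t\<close> for \<open>x\<^sub>j\<close> and comparing coefficients of
  \<open>t\<^sup>2\<close> gives \<open>a\<^sub>j Q(x) = \<phi>(\<partial>\<^sub>j Y(x)) \<in> V\<close> for every \<open>j\<close>, so \<open>Q(x)\<close> stabilizes \<open>V\<close>.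
  The map \<open>y \<mapsto> Q(x)\<close> is semilinear for the Frobenius map of \<open>K\<close>, and it is injective: \<open>Q(x) = 0\<close>
  means \<open>\<phi>\<^sup>2\<close> divides \<open>\<phi>(Y)\<close>, and a Cartier operator dual to \<open>a\<^sub>i\<close> then shows that
  \<open>\<phi>\<close> divides \<open>Y\<^sub>i\<close>. Hence the stabilizer of \<open>V\<close>, a field, has degree at least
  \<open>i\<^sub>1(\<phi>)\<close> over \<open>K\<^sup>2\<close>; it contains the value set \<open>L\<close> of an anisotropic \<open>s\<close>-fold quasi-Pfister
  form, and \<open>V\<close> has a basis over the field \<open>L\<close>.
\<close>

subsection \<open>Evaluation of multivariate polynomials\<close>

lemma poly_mapping_eq_sum_single:
  "(p :: _ \<Rightarrow>\<^sub>0 'b::comm_monoid_add) = (\<Sum>m\<in>Poly_Mapping.keys p. Poly_Mapping.single m (Poly_Mapping.lookup p m))"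
  by (rule poly_mapping_eqI)
    (auto simp: lookup_sum lookup_single when_def in_keys_iff)

text \<open>Evaluation, truncation and the Cartier operator are additive, so identities about them
  need checking on monomials only.\<close>

lemma poly_mapping_single_induct [case_names single add]:
  fixes p :: "'k \<Rightarrow>\<^sub>0 'b::comm_monoid_add"
  assumes s: "\<And>m c. P (Poly_Mapping.single m c)"
    and a: "\<And>p q. P p \<Longrightarrow> P q \<Longrightarrow> P (p + q)"
  shows "P p"
proof -
  have "P (\<Sum>m\<in>A. Poly_Mapping.single m (Poly_Mapping.lookup p m))" if "finite A" for A
    using that
  proof induction
    case empty
    \<comment> \<open>The zero polynomial is a monomial with coefficient 0.\<close>
    show ?case using s[of undefined 0] by simp
  qed (simp add: s a)
  then show ?thesis
    using poly_mapping_eq_sum_single[of p] by (metis finite_keys)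
qed

text \<open>The same facts serve the embedding of fields, \<open>mconst\<close>,
  \<open>truncate\<close> and evaluation itself, all of which are ring homomorphisms and become
  instances.\<close>

locale coeff_hom =
  fixes h :: "'a::comm_ring_1 \<Rightarrow> 'b::comm_ring_1"
  assumes add: "h (u + v) = h u + h v"
    and mult: "h (u * v) = h u * h v"
    and one: "h 1 = 1"
begin

lemma zero: "h 0 = 0"
  using add[of 0 0] by simp

lemma power: "h (u ^ k) = h u ^ k"
  by (induction k) (simp_all add: one mult)

lemma sum: "h (\<Sum>i\<in>A. f i) = (\<Sum>i\<in>A. h (f i))"
  by (induction A rule: infinite_finite_induct) (simp_all add: zero add)

lemma prod: "h (\<Prod>i\<in>A. f i) = (\<Prod>i\<in>A. h (f i))"
  by (induction A rule: infinite_finite_induct) (simp_all add: one mult)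

lemma qf_val_hom:
  "h (qf_val a v) = qf_val (map h a) (\<lambda>i. h (v i))"
  by (simp add: qf_val_def sum mult power)

text \<open>Monomials outside the support contribute 0. Two polynomials can thus be evaluated over a
  common set of monomials.\<close>

lemma mpoly_eval_superset:
  assumes "finite A" "Poly_Mapping.keys p \<subseteq> A"
  shows "mpoly_eval h x p =
    (\<Sum>m\<in>A. h (Poly_Mapping.lookup p m) *
      (\<Prod>i\<in>Poly_Mapping.keys m. x i ^ Poly_Mapping.lookup m i))"
  unfolding mpoly_eval_def
  by (rule sum.mono_neutral_left) (use assms in \<open>auto simp: in_keys_iff zero\<close>)

lemma mpoly_eval_single:
  "mpoly_eval h x (Poly_Mapping.single m c) =
    h c * (\<Prod>i\<in>Poly_Mapping.keys m. x i ^ Poly_Mapping.lookup m i)"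
  by (subst mpoly_eval_superset[of "{m}"]) auto

lemma mpoly_eval_add: "mpoly_eval h x (p + q) = mpoly_eval h x p + mpoly_eval h x q"
proof -
  let ?A = "Poly_Mapping.keys p \<union> Poly_Mapping.keys q"
  show ?thesis
    using keys_add[of p q]
    by (simp add: mpoly_eval_superset[of ?A] lookup_add add distrib_right sum.distrib)
qed

lemma monomial_eval_add:
  fixes x :: "nat \<Rightarrow> 'b"
  shows "(\<Prod>i\<in>Poly_Mapping.keys (m + m'). x i ^ Poly_Mapping.lookup (m + m') i) =
    (\<Prod>i\<in>Poly_Mapping.keys m. x i ^ Poly_Mapping.lookup m i) *
    (\<Prod>i\<in>Poly_Mapping.keys m'. x i ^ Poly_Mapping.lookup m' i)"
proof -
  let ?A = "Poly_Mapping.keys m \<union> Poly_Mapping.keys m'"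
  have ext: "(\<Prod>i\<in>Poly_Mapping.keys k. x i ^ Poly_Mapping.lookup k i) =
      (\<Prod>i\<in>?A. x i ^ Poly_Mapping.lookup k i)"
    if "Poly_Mapping.keys k \<subseteq> ?A" for k
    by (rule prod.mono_neutral_left) (use that in \<open>auto simp: in_keys_iff\<close>)
  show ?thesis
    unfolding ext[OF keys_add] ext[OF Un_upper1] ext[OF Un_upper2]
    by (simp add: lookup_add power_add prod.distrib)
qed

lemma mpoly_eval_mult: "mpoly_eval h x (p * q) = mpoly_eval h x p * mpoly_eval h x q"
proof (induction p rule: poly_mapping_single_induct)
  case (single m c)
  show ?case
  proof (induction q rule: poly_mapping_single_induct)
    case (single m' c')
    show ?case
      by (simp add: mult_single mpoly_eval_single monomial_eval_add mult ac_simps)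
  qed (simp add: distrib_left mpoly_eval_add)
qed (simp add: distrib_right mpoly_eval_add)

lemma coeff_hom_mpoly_eval: "coeff_hom (mpoly_eval h x)"
  by unfold_locales
    (simp_all add: mpoly_eval_add mpoly_eval_mult mpoly_eval_single one flip: single_one)

lemmas mpoly_eval_zero = coeff_hom.zero[OF coeff_hom_mpoly_eval]
  and mpoly_eval_power = coeff_hom.power[OF coeff_hom_mpoly_eval]
  and mpoly_eval_sum = coeff_hom.sum[OF coeff_hom_mpoly_eval]
  and mpoly_eval_prod = coeff_hom.prod[OF coeff_hom_mpoly_eval]
  and mpoly_eval_qf_val' = coeff_hom.qf_val_hom[OF coeff_hom_mpoly_eval]

end

section \<open>Constants, variables and truncation to finitely many variables\<close>

definition mconst :: "'a::zero \<Rightarrow> (nat \<Rightarrow>\<^sub>0 nat) \<Rightarrow>\<^sub>0 'a" where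
  "mconst c = Poly_Mapping.single 0 c"

definition mvar :: "nat \<Rightarrow> (nat \<Rightarrow>\<^sub>0 nat) \<Rightarrow>\<^sub>0 'a::zero_neq_one" where
  "mvar i = Poly_Mapping.single (Poly_Mapping.single i 1) 1"

interpretation mconst: coeff_hom "mconst :: 'a::comm_ring_1 \<Rightarrow> _"
  by unfold_locales (simp_all add: mconst_def single_add mult_single)

lemma (in coeff_hom) mpoly_eval_mconst [simp]: "mpoly_eval h x (mconst c) = h c"
  by (simp add: mconst_def mpoly_eval_single)

lemma (in coeff_hom) mpoly_eval_mvar [simp]: "mpoly_eval h x (mvar i) = x i"
  by (simp add: mvar_def mpoly_eval_single one)

lemma qf_poly_eq: "qf_poly a = qf_val (map mconst a) (mvar :: nat \<Rightarrow> _ \<Rightarrow>\<^sub>0 'a::comm_ring_1)"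
proof -
  have "(Poly_Mapping.single i 2 :: nat \<Rightarrow>\<^sub>0 nat) = Poly_Mapping.single i 1 + Poly_Mapping.single i 1"
    for i by (simp flip: single_add add: numeral_2_eq_2)
  then show ?thesis
    by (simp add: qf_poly_def qf_val_def mconst_def mvar_def power2_eq_square mult_single)
qed

lemma (in coeff_hom) mpoly_eval_qf_poly: "mpoly_eval h x (qf_poly a) = qf_val (map h a) x"
  by (simp add: qf_poly_eq mpoly_eval_qf_val' comp_def)

lemma (in coeff_hom) mpoly_eval_qf_val:
  "mpoly_eval h x (qf_val (map mconst a) Y) = qf_val (map h a) (\<lambda>i. mpoly_eval h x (Y i))"
  by (simp add: mpoly_eval_qf_val' comp_def)

text \<open>Sets all variables of index at least \<open>n\<close> to 0. The polynomial ring has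
  infinitely many variables, while the kernel condition of the function field speaks of polynomials
  in the first \<open>n\<close>; truncation passes to these without changing the value at a point of
  \<open>vec_space n\<close>.\<close>

definition truncate :: "nat \<Rightarrow> ((nat \<Rightarrow>\<^sub>0 nat) \<Rightarrow>\<^sub>0 'a::comm_ring_1) \<Rightarrow> (nat \<Rightarrow>\<^sub>0 nat) \<Rightarrow>\<^sub>0 'a" where
  "truncate n = mpoly_eval mconst (\<lambda>i. if i < n then mvar i else 0)"

interpretation truncate: coeff_hom "truncate n :: _ \<Rightarrow> (nat \<Rightarrow>\<^sub>0 nat) \<Rightarrow>\<^sub>0 'a::comm_ring_1"
  unfolding truncate_def by (rule mconst.coeff_hom_mpoly_eval)

lemma poly_in_vars_add: "poly_in_vars n p \<Longrightarrow> poly_in_vars n q \<Longrightarrow> poly_in_vars n (p + q)"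
  using keys_add[of p q] unfolding poly_in_vars_def by blast

lemma poly_in_vars_mult: "poly_in_vars n p \<Longrightarrow> poly_in_vars n q \<Longrightarrow> poly_in_vars n (p * q)"
  unfolding poly_in_vars_def
proof
  fix m
  assume p: "\<forall>m\<in>Poly_Mapping.keys p. Poly_Mapping.keys m \<subseteq> {..<n}"
    and q: "\<forall>m\<in>Poly_Mapping.keys q. Poly_Mapping.keys m \<subseteq> {..<n}"
    and "m \<in> Poly_Mapping.keys (p * q)"
  then obtain k l where "m = k + l" "k \<in> Poly_Mapping.keys p" "l \<in> Poly_Mapping.keys q"
    using keys_mult[of p q] by blast
  then show "Poly_Mapping.keys m \<subseteq> {..<n}"
    using p q keys_add[of k l] by (metis Un_least order_trans)
qed

lemma poly_in_vars_mconst: "poly_in_vars n (mconst c)"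
  by (simp add: poly_in_vars_def mconst_def)

lemma poly_in_vars_mvar: "i < n \<Longrightarrow> poly_in_vars n (mvar i)"
  by (simp add: poly_in_vars_def mvar_def)

lemma poly_in_vars_one: "poly_in_vars n (1 :: _ \<Rightarrow>\<^sub>0 'a::comm_ring_1)"
  by (simp add: poly_in_vars_def)

lemma poly_in_vars_power: "poly_in_vars n p \<Longrightarrow> poly_in_vars n ((p::_ \<Rightarrow>\<^sub>0 'a::comm_ring_1) ^ k)"
  by (induction k) (simp_all add: poly_in_vars_mult poly_in_vars_one)

lemma poly_in_vars_prod:
  "(\<And>i. i \<in> A \<Longrightarrow> poly_in_vars n (f i)) \<Longrightarrow>
    poly_in_vars n (\<Prod>i\<in>A. f i :: _ \<Rightarrow>\<^sub>0 'a::comm_ring_1)"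
  by (induction A rule: infinite_finite_induct)
    (simp_all add: poly_in_vars_mult poly_in_vars_one)

lemma poly_in_vars_truncate: "poly_in_vars n (truncate n p)"
proof (induction p rule: poly_mapping_single_induct)
  case (single m c)
  have "poly_in_vars n (if i < n then mvar i else 0 :: _ \<Rightarrow>\<^sub>0 'a)" for i
    by (cases "i < n") (simp add: poly_in_vars_mvar, simp add: poly_in_vars_def)
  then show ?case
    unfolding truncate_def mconst.mpoly_eval_single
    by (intro poly_in_vars_mult poly_in_vars_mconst poly_in_vars_prod poly_in_vars_power)
qed (simp add: truncate.add poly_in_vars_add)

lemma (in coeff_hom) mpoly_eval_truncate:
  assumes "x \<in> vec_space n"
  shows "mpoly_eval h x (truncate n p) = mpoly_eval h x p"
proof (induction p rule: poly_mapping_single_induct)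
  case (single m c)
  have "mpoly_eval h x (if i < n then mvar i else 0) = x i" for i
    using assms by (simp add: vec_space_def mpoly_eval_zero)
  then show ?case
    by (simp add: truncate_def mconst.mpoly_eval_single mpoly_eval_single mpoly_eval_mult mpoly_eval_prod
        mpoly_eval_power)
qed (simp add: truncate.add mpoly_eval_add)

lemma truncate_qf_val:
  "truncate n (qf_val (map mconst a) Y) = qf_val (map mconst a) (\<lambda>i. truncate n (Y i))"
  by (simp add: truncate_def mconst.mpoly_eval_qf_val)

lemma truncate_qf_poly: "truncate (length a) (qf_poly a) = qf_poly a"
  unfolding qf_poly_eq truncate_qf_val
  by (simp add: qf_val_def truncate_def)

subsection \<open>Squares in characteristic two\<close>

lemma add_power2_char_two:
  assumes "(2::'r::comm_ring_1) = 0"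
  shows "((x::'r) + y)\<^sup>2 = x\<^sup>2 + y\<^sup>2"
  by (simp add: power2_sum assms)

lemma (in coeff_hom) two_eq_0:
  assumes "(2::'a) = 0"
  shows "(2::'b) = 0"
  using add[of 1 1] assms by (simp add: one zero)

lemma qf_val_add:
  assumes "(2::'r::comm_ring_1) = 0"
  shows "qf_val a (\<lambda>i. v i + w i :: 'r) = qf_val a v + qf_val a w"
  by (simp add: qf_val_def add_power2_char_two[OF assms] distrib_left sum.distrib)

lemma qf_val_scale: "qf_val a (\<lambda>i. c * v i) = c\<^sup>2 * qf_val a v"
  by (simp add: qf_val_def sum_distrib_left power_mult_distrib mult.left_commute)

lemma qf_val_sum:
  assumes "(2::'r::comm_ring_1) = 0"
  shows "qf_val a (\<lambda>i. \<Sum>w\<in>B. v w i :: 'r) = (\<Sum>w\<in>B. qf_val a (v w))"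
  by (induction B rule: infinite_finite_induct)
    (simp_all add: qf_val_add[OF assms], simp_all add: qf_val_def)

subsection \<open>Cartier operators\<close>

text \<open>Keeps the monomials that are squares, takes their square roots and applies
  \<open>f\<close> to the coefficients. If \<open>f\<close> is additive with f(c^2 v) = c f(v), this
  is a Cartier operator: inverse to Frobenius in its linearity, as proved below.\<close>

definition cartier ::
    "('a::comm_ring_1 \<Rightarrow> 'a) \<Rightarrow> ((nat \<Rightarrow>\<^sub>0 nat) \<Rightarrow>\<^sub>0 'a) \<Rightarrow> (nat \<Rightarrow>\<^sub>0 nat) \<Rightarrow>\<^sub>0 'a" where
  "cartier f p = Poly_Mapping.map f (Poly_Mapping.map_key (\<lambda>m. m + m) p)"

context
  fixes f :: "'a::comm_ring_1 \<Rightarrow> 'a"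
  assumes f_add: "\<And>u v. f (u + v) = f u + f v"
    and f_scale: "\<And>c v. f (c\<^sup>2 * v) = c * f v"
begin

lemma f_zero: "f 0 = 0"
  using f_add[of 0 0] by simp

lemma inj_double: "inj (\<lambda>m::nat \<Rightarrow>\<^sub>0 nat. m + m)"
proof (rule injI, rule poly_mapping_eqI)
  fix m m' :: "nat \<Rightarrow>\<^sub>0 nat" and k
  assume "m + m = m' + m'"
  then have "Poly_Mapping.lookup (m + m) k = Poly_Mapping.lookup (m' + m') k" by simp
  then show "Poly_Mapping.lookup m k = Poly_Mapping.lookup m' k" by (simp add: lookup_add)
qed

lemma lookup_cartier: "Poly_Mapping.lookup (cartier f p) m = f (Poly_Mapping.lookup p (m + m))"
  by (simp add: cartier_def Poly_Mapping.map.rep_eq map_key.rep_eq inj_double when_def f_zero)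

lemma cartier_add: "cartier f (p + q) = cartier f p + cartier f q"
  by (rule poly_mapping_eqI) (simp add: lookup_cartier lookup_add f_add)

lemma cartier_sum: "cartier f (\<Sum>i\<in>A. g i) = (\<Sum>i\<in>A. cartier f (g i))"
proof -
  have "cartier f 0 = 0" by (rule poly_mapping_eqI) (simp add: lookup_cartier f_zero)
  then show ?thesis
    by (induction A rule: infinite_finite_induct) (simp_all add: cartier_add)
qed

lemma cartier_mconst: "cartier f (mconst c) = mconst (f c)"
proof (rule poly_mapping_eqI)
  fix m :: "nat \<Rightarrow>\<^sub>0 nat"
  have "m + m = 0 \<longleftrightarrow> m = 0"
    using inj_double unfolding inj_def by (metis add_0)
  then show "Poly_Mapping.lookup (cartier f (mconst c)) m = Poly_Mapping.lookup (mconst (f c)) m"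
    by (auto simp: lookup_cartier mconst_def lookup_single when_def f_zero)
qed

text \<open>Adding \<open>k + k\<close> to an exponent vector does not change whether it is a
  double. If \<open>l\<close> is one, halving splits off \<open>k\<close>; otherwise both sides
  vanish.\<close>

lemma cartier_monomial_mult:
  "cartier f (Poly_Mapping.single (k + k) (c\<^sup>2) * Poly_Mapping.single l d) =
    Poly_Mapping.single k c * cartier f (Poly_Mapping.single l d)"
proof (cases "\<exists>l'. l = l' + l'")
  case True
  then obtain l' where l: "l = l' + l'" by blast
  have *: "cartier f (Poly_Mapping.single (m + m) e) = Poly_Mapping.single m (f e)" for m e
    by (rule poly_mapping_eqI)
      (auto simp: lookup_cartier lookup_single when_def f_zero dest: injD[OF inj_double])
  have "(k + k) + (l' + l') = (k + l') + (k + l')" by (simp add: ac_simps)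
  then show ?thesis by (simp only: l mult_single * f_scale)
next
  case False
  have "k + k + l \<noteq> m + m" for m
  proof
    assume *: "k + k + l = m + m"
    \<comment> \<open>Subtraction of naturals is truncated, but 2k + l = 2m at each index forces k
      to be at most m, so nothing is cut off.\<close>
    have "l = (m - k) + (m - k)"
    proof (rule poly_mapping_eqI)
      fix i
      have "Poly_Mapping.lookup (k + k + l) i = Poly_Mapping.lookup (m + m) i" using * by simp
      then show "Poly_Mapping.lookup l i = Poly_Mapping.lookup ((m - k) + (m - k)) i"
        by (simp add: lookup_add lookup_minus)
    qed
    then show False using False by blast
  qed
  then have "cartier f (Poly_Mapping.single (k + k + l) e) = 0" for e
    by (intro poly_mapping_eqI) (auto simp: lookup_cartier lookup_single when_def f_zero)
  moreover have "cartier f (Poly_Mapping.single l e) = 0" for e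
    using False
    by (intro poly_mapping_eqI) (auto simp: lookup_cartier lookup_single when_def f_zero)
  ultimately show ?thesis by (simp add: mult_single)
qed

text \<open>Squaring is additive in characteristic 2, so both sides are additive in \<open>S\<close>
  as well as in \<open>p\<close>, and monomials suffice.\<close>

lemma cartier_square_mult:
  assumes two: "(2::'a) = 0"
  shows "cartier f (S\<^sup>2 * p) = S * cartier f p"
proof (induction S rule: poly_mapping_single_induct)
  case (single k c)
  show ?case
  proof (induction p rule: poly_mapping_single_induct)
    case (single l d)
    then show ?case
      using cartier_monomial_mult[of k c l d] by (simp add: power2_eq_square mult_single)
  qed (simp add: distrib_left cartier_add)
next
  case (add p' q')
  have "(2 :: (nat \<Rightarrow>\<^sub>0 nat) \<Rightarrow>\<^sub>0 'a) = 0" by (rule mconst.two_eq_0[OF two])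
  from add_power2_char_two[OF this, of p' q'] show ?case
    using add by (simp add: distrib_right cartier_add)
qed

end

subsection \<open>Anisotropic forms as independent sets over the field of squares\<close>

lemma qf_val_cong: "(\<And>i. i < length a \<Longrightarrow> v i = w i) \<Longrightarrow> qf_val a v = qf_val a w"
  by (simp add: qf_val_def)

lemma qf_val_clip: "qf_val a (\<lambda>i. if i < length a then v i else 0) = qf_val a v"
  by (rule qf_val_cong) simp

lemma clip_in_vec_space: "(\<lambda>i. if i < n then v i else 0) \<in> vec_space n"
  by (simp add: vec_space_def)

lemma value_set_eq_range: "value_set a = range (qf_val a)"
proof
  show "value_set a \<subseteq> range (qf_val a)" by (auto simp: value_set_def)
  show "range (qf_val a) \<subseteq> value_set a"
  proof
    fix u assume "u \<in> range (qf_val a)"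
    then obtain v where "u = qf_val a v" by blast
    then have "u = qf_val a (\<lambda>i. if i < length a then v i else 0)" by (simp add: qf_val_clip)
    then show "u \<in> value_set a"
      unfolding value_set_def using clip_in_vec_space by (rule image_eqI)
  qed
qed

text \<open>\<open>qf_val\<close> reads only the first \<open>length a\<close> coordinates, so this
  form avoids carrying \<open>vec_space\<close> along.\<close>

lemma anisotropic_iff_coordinates:
  "anisotropic a \<longleftrightarrow> (\<forall>v. qf_val a v = 0 \<longrightarrow> (\<forall>i<length a. v i = 0))"
proof
  assume a: "anisotropic a"
  show "\<forall>v. qf_val a v = 0 \<longrightarrow> (\<forall>i<length a. v i = 0)"
  proof (intro allI impI)
    fix v i
    assume v: "qf_val a v = 0" and i: "i < length a"
    have "(\<lambda>i. if i < length a then v i else 0) = (\<lambda>_. 0)"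
      using a v clip_in_vec_space[of "length a" v] unfolding anisotropic_def
      by (metis qf_val_clip)
    then show "v i = 0" using i by (metis (full_types))
  qed
next
  assume "\<forall>v. qf_val a v = 0 \<longrightarrow> (\<forall>i<length a. v i = 0)"
  then show "anisotropic a"
    unfolding anisotropic_def vec_space_def fun_eq_iff by (metis (mono_tags) mem_Collect_eq not_le)
qed

lemma qf_val_Cons: "qf_val (y # a) v = y * (v 0)\<^sup>2 + qf_val a (\<lambda>i. v (Suc i))"
  by (simp add: qf_val_def sum.lessThan_Suc_shift del: sum.lessThan_Suc)

lemma qf_val_append: "qf_val (a @ b) v = qf_val a v + qf_val b (\<lambda>i. v (length a + i))"
  by (induction a arbitrary: v) (simp_all add: qf_val_Cons, simp_all add: qf_val_def add.assoc)

lemma qf_val_map_mult: "qf_val (map ((*) y) a) v = y * qf_val a v"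
  by (simp add: qf_val_def sum_distrib_left mult.assoc)

lemma value_set_map_mult: "value_set (map ((*) y) a) = (*) y ` value_set a"
  by (auto simp: value_set_eq_range qf_val_map_mult)

lemma anisotropic_map_mult:
  "(y::'b::field) \<noteq> 0 \<Longrightarrow> anisotropic a \<Longrightarrow> anisotropic (map ((*) y) a)"
  by (simp add: anisotropic_iff_coordinates qf_val_map_mult)

lemma value_set_append: "value_set (a @ b) = {u + v | u v. u \<in> value_set a \<and> v \<in> value_set b}"
proof -
  have sum: "qf_val (a @ b) (\<lambda>i. if i < length a then v i else w (i - length a)) =
      qf_val a v + qf_val b w" for v w
    by (simp add: qf_val_append cong: qf_val_cong)
  show ?thesis
  proof (intro set_eqI iffI)
    fix u assume "u \<in> value_set (a @ b)"
    then show "u \<in> {u + v | u v. u \<in> value_set a \<and> v \<in> value_set b}"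
      unfolding value_set_eq_range by (auto simp: qf_val_append)
  next
    fix u assume "u \<in> {u + v | u v. u \<in> value_set a \<and> v \<in> value_set b}"
    then obtain v w where "u = qf_val a v + qf_val b w" unfolding value_set_eq_range by blast
    then show "u \<in> value_set (a @ b)"
      unfolding value_set_eq_range by (simp flip: sum)
  qed
qed

lemma value_set_zero: "0 \<in> value_set a"
  unfolding value_set_eq_range by (rule range_eqI[of _ _ "\<lambda>_. 0"]) (simp add: qf_val_def)

lemma value_set_square_mult: "u \<in> value_set a \<Longrightarrow> c\<^sup>2 * u \<in> value_set a"
  unfolding value_set_eq_range by (auto simp flip: qf_val_scale)

section \<open>The field as a vector space over its squares\<close>

locale char_two =
  fixes ty :: "'b::field itself"
  assumes two_eq_0: "(2::'b) = 0"
begin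

lemma add_self: "(u::'b) + u = 0"
  using two_eq_0 by (metis mult_2 mult_zero_left)

lemma minus_eq: "- u = (u::'b)"
  using add_self by (simp add: eq_neg_iff_add_eq_0 minus_equation_iff)

text \<open>This is K as a vector space over its subfield of squares, with scalars named by their
  square roots. Value sets become spans and anisotropy becomes linear independence, so the theory of
  bases applies.\<close>

sublocale sq: vector_space "\<lambda>(c::'b) v. c\<^sup>2 * v"
  by unfold_locales
    (simp_all add: algebra_simps add_power2_char_two[OF two_eq_0] power_mult_distrib)

lemma value_set_eq_span: "value_set a = sq.span (set (a :: 'b list))"
proof (induction a)
  case Nil
  show ?case by (auto simp: value_set_eq_range qf_val_def)
next
  case (Cons y a)
  have "u \<in> value_set (y # a) \<longleftrightarrow> (\<exists>c. u - c\<^sup>2 * y \<in> value_set a)" for u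
  proof
    assume "u \<in> value_set (y # a)"
    then show "\<exists>c. u - c\<^sup>2 * y \<in> value_set a"
      unfolding value_set_eq_range
      by (elim rangeE) (simp add: qf_val_Cons, metis add_diff_cancel_left' mult.commute rangeI)
  next
    assume "\<exists>c. u - c\<^sup>2 * y \<in> value_set a"
    then obtain c v where "u - c\<^sup>2 * y = qf_val a v" by (auto simp: value_set_eq_range)
    then have "u = qf_val (y # a) (\<lambda>i. case i of 0 \<Rightarrow> c | Suc k \<Rightarrow> v k)"
      by (simp add: qf_val_Cons algebra_simps)
    then show "u \<in> value_set (y # a)" unfolding value_set_eq_range by blast
  qed
  then show ?case by (auto simp: sq.span_insert Cons)
qed

lemma value_set_add:
  "u \<in> value_set a \<Longrightarrow> v \<in> value_set a \<Longrightarrow> u + v \<in> value_set (a :: 'b list)"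
  by (simp add: value_set_eq_span sq.span_add)

text \<open>By additivity \<open>v + w\<close> has value 0, hence vanishes on the coordinates of an
  anisotropic form.\<close>

lemma qf_val_inj:
  assumes "anisotropic a" "qf_val a v = qf_val (a :: 'b list) w" "i < length a"
  shows "v i = w i"
proof -
  have "qf_val a (\<lambda>i. v i + w i) = 0"
    using assms(2) by (simp add: qf_val_add[OF two_eq_0] add_self)
  then have "v i + w i = 0"
    using assms by (metis (no_types, lifting) anisotropic_iff_coordinates)
  then show ?thesis using minus_eq by (metis eq_neg_iff_add_eq_0)
qed

lemma anisotropic_Cons:
  "anisotropic (y # a) \<longleftrightarrow> anisotropic a \<and> y \<notin> value_set (a :: 'b list)"
proof
  assume L: "anisotropic (y # a)"
  have "anisotropic a"
    unfolding anisotropic_iff_coordinates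
  proof (intro allI impI)
    fix v i assume "qf_val a v = 0" "i < length a"
    then show "v i = 0"
      using L[unfolded anisotropic_iff_coordinates, rule_format,
          of "\<lambda>i. case i of 0 \<Rightarrow> 0 | Suc k \<Rightarrow> v k" "Suc i"]
      by (simp add: qf_val_Cons)
  qed
  moreover have "y \<notin> value_set a"
  proof
    assume "y \<in> value_set a"
    then obtain v where "y = qf_val a v" by (auto simp: value_set_eq_range)
    then show False
      using L[unfolded anisotropic_iff_coordinates, rule_format,
          of "\<lambda>i. case i of 0 \<Rightarrow> 1 | Suc k \<Rightarrow> v k" 0]
      by (simp add: qf_val_Cons add_self)
  qed
  ultimately show "anisotropic a \<and> y \<notin> value_set a" by blast
next
  assume R: "anisotropic a \<and> y \<notin> value_set a"
  show "anisotropic (y # a)"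
    unfolding anisotropic_iff_coordinates
  proof (intro allI impI)
    fix v i assume v: "qf_val (y # a) v = 0" and i: "i < length (y # a)"
    have v0: "v 0 = 0"
    proof (rule ccontr)
      assume nz: "v 0 \<noteq> 0"
      have "(v 0)\<^sup>2 * y = qf_val a (\<lambda>i. v (Suc i))"
        using v minus_eq by (simp add: qf_val_Cons add_eq_0_iff2 mult.commute)
      then have "y = (inverse (v 0))\<^sup>2 * qf_val a (\<lambda>i. v (Suc i))"
        using nz by (simp add: field_simps)
      then show False
        using R value_set_square_mult by (metis rangeI value_set_eq_range)
    qed
    then have "\<forall>k<length a. v (Suc k) = 0"
      using R v anisotropic_iff_coordinates[THEN iffD1, rule_format, of a "\<lambda>i. v (Suc i)"]
      by (simp add: qf_val_Cons)
    then show "v i = 0" using v0 i by (cases i) auto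
  qed
qed

text \<open>An isotropic vector is a linear relation between the coefficients. Distinctness is a
  separate condition because a set forgets repetitions, and the form with coefficients y, y is
  isotropic.\<close>

lemma anisotropic_iff_independent:
  "anisotropic a \<longleftrightarrow> distinct a \<and> sq.independent (set (a :: 'b list))"
proof (induction a)
  case Nil
  show ?case by (simp add: anisotropic_iff_coordinates sq.independent_empty)
next
  case (Cons y a)
  then show ?case
    using sq.span_base[of y "set a"]
    by (auto simp: anisotropic_Cons sq.independent_insert value_set_eq_span)
qed

lemma anisotropic_cong_mset: "mset a = mset b \<Longrightarrow> anisotropic a = anisotropic (b :: 'b list)"
  unfolding anisotropic_iff_independent by (metis mset_eq_imp_distinct_iff mset_eq_setD)

lemma value_set_cong_mset: "mset a = mset b \<Longrightarrow> value_set a = value_set (b :: 'b list)"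
  unfolding value_set_eq_span by (metis mset_eq_setD)

lemma anisotropic_append:
  assumes "anisotropic a" "anisotropic b"
    and disj: "\<And>u. u \<in> value_set a \<Longrightarrow> u \<in> value_set b \<Longrightarrow> u = 0"
  shows "anisotropic (a @ b :: 'b list)"
  unfolding anisotropic_iff_coordinates
proof (intro allI impI)
  fix v i assume v: "qf_val (a @ b) v = 0" and i: "i < length (a @ b)"
  let ?u = "qf_val a v" and ?w = "qf_val b (\<lambda>i. v (length a + i))"
  have eq: "?u = ?w" using v minus_eq by (simp add: qf_val_append add_eq_0_iff2)
  have "?u \<in> value_set a" "?u \<in> value_set b" 
    unfolding value_set_eq_range by (rule rangeI, unfold eq, rule rangeI)
  then have "?u = 0" by (rule disj)
  with eq have "?u = 0" "?w = 0" by simp_all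
  with assms(1,2) have "\<forall>i<length a. v i = 0" "\<forall>k<length b. v (length a + k) = 0"
    unfolding anisotropic_iff_coordinates by blast+
  then show "v i = 0"
    using i by (metis add_diff_inverse_nat length_append nat_add_left_cancel_less)
qed

text \<open>The coefficients of \<open>a\<close> are independent and lie in the span of those of
  \<open>b\<close>.\<close>

lemma length_le_if_value_set_subset:
  assumes "anisotropic a" "value_set a \<subseteq> value_set (b :: 'b list)"
  shows "length a \<le> length b"
proof -
  have "set a \<subseteq> sq.span (set b)"
    using assms(2) sq.span_superset[of "set a"] by (simp add: value_set_eq_span)
  then have "card (set a) \<le> card (set b)"
    using sq.independent_span_bound assms(1) by (auto simp: anisotropic_iff_independent)
  then show ?thesis
    using assms(1) card_length[of b] by (simp add: anisotropic_iff_independent distinct_card)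
qed

text \<open>Each coefficient of \<open>a\<close> is a value of \<open>b\<close>, and additivity
  extends this choice to a linear map preserving values. It is bijective because in an anisotropic
  form the value determines the vector.\<close>

lemma isometric_if_value_set_eq:
  assumes a: "anisotropic a" and b: "anisotropic b" and eq: "value_set a = value_set (b :: 'b list)"
  shows "isometric a b"
proof -
  define n where "n = length a"
  have n: "length b = n"
    using length_le_if_value_set_subset[OF a, of b] length_le_if_value_set_subset[OF b, of a] eq
    by (simp add: n_def)
  have "\<exists>v. a ! j = qf_val b v" if "j < n" for j
  proof -
    have "a ! j \<in> value_set a"
      using that sq.span_base[of "a ! j" "set a"] by (simp add: value_set_eq_span n_def)
    then show ?thesis using eq by (auto simp: value_set_eq_range)
  qed
  then obtain N where N: "\<And>j. j < n \<Longrightarrow> a ! j = qf_val b (N j)" by metis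
  \<comment> \<open>The columns of the matrix are the chosen vectors of \<open>b\<close>
    representing the coefficients of \<open>a\<close>.\<close>
  define M where "M i j = N j i" for i j
  have val: "qf_val b (mat_app M n v) = qf_val a v" for v :: "nat \<Rightarrow> 'b"
  proof -
    have "qf_val b (mat_app M n v) = qf_val b (\<lambda>i. \<Sum>j<n. v j * N j i)"
      by (rule qf_val_cong) (simp add: mat_app_def M_def n mult.commute)
    also have "\<dots> = (\<Sum>j<n. (v j)\<^sup>2 * qf_val b (N j))"
      by (simp add: qf_val_sum[OF two_eq_0] qf_val_scale)
    also have "\<dots> = qf_val a v"
      by (simp add: qf_val_def[of a] N n_def mult.commute)
    finally show ?thesis .
  qed
  have eqI: "v = w" if "v \<in> vec_space n" "w \<in> vec_space n" "\<And>i. i < n \<Longrightarrow> v i = w i"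
    for v w :: "nat \<Rightarrow> 'b"
  proof
    fix i show "v i = w i" using that by (cases "i < n") (simp_all add: vec_space_def)
  qed
  have mem: "mat_app M n v \<in> vec_space n" for v :: "nat \<Rightarrow> 'b"
    by (simp add: mat_app_def vec_space_def)
  have "bij_betw (mat_app M n) (vec_space n) (vec_space n)"
  proof (rule bij_betwI')
    fix v w :: "nat \<Rightarrow> 'b" assume vw: "v \<in> vec_space n" "w \<in> vec_space n"
    show "mat_app M n v = mat_app M n w \<longleftrightarrow> v = w"
    proof
      assume "mat_app M n v = mat_app M n w"
      then have "qf_val a v = qf_val a w" by (metis val)
      then show "v = w" using vw qf_val_inj[OF a] by (intro eqI) (simp_all add: n_def)
    qed simp
  next
    fix w :: "nat \<Rightarrow> 'b" assume w: "w \<in> vec_space n"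
    have "qf_val b w \<in> value_set a" using eq by (auto simp: value_set_eq_range)
    then obtain v where v: "v \<in> vec_space n" "qf_val b w = qf_val a v"
      by (auto simp: value_set_def n_def)
    then have "qf_val b w = qf_val b (mat_app M n v)" by (simp add: val)
    then have "w = mat_app M n v" using w mem qf_val_inj[OF b] by (intro eqI) (simp_all add: n)
    then show "\<exists>v\<in>vec_space n. w = mat_app M n v" using v by blast
  qed (rule mem)
  then show ?thesis
    unfolding isometric_def using val n by (auto simp: n_def)
qed

subsection \<open>Quasi-Pfister forms\<close>

lemma quasi_pfister_Nil: "quasi_pfister [] = [1]"
  by (simp add: quasi_pfister_def)

lemma quasi_pfister_Cons:
  "quasi_pfister (y # xs) = quasi_pfister xs @ map ((*) y) (quasi_pfister xs)"
proof -
  have "map ((*) 1) l = l" for l :: "'c::comm_ring_1 list" by (induction l) simp_all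
  then show ?thesis by (simp add: quasi_pfister_def qf_tensor_def)
qed

lemma length_quasi_pfister: "length (quasi_pfister xs) = 2 ^ length xs"
  by (induction xs) (simp_all add: quasi_pfister_Nil quasi_pfister_Cons)

lemma value_set_quasi_pfister_Cons:
  "value_set (quasi_pfister (y # xs)) =
    {u + y * v | u v. u \<in> value_set (quasi_pfister xs) \<and> v \<in> value_set (quasi_pfister xs)}"
  by (auto simp: quasi_pfister_Cons value_set_append value_set_map_mult)

text \<open>A new slot y turns the value set L into L + yL, which is closed under products because
  y^2 is a scalar. Together with inverses this makes the value set a field, generated over the
  squares by the slots.\<close>

lemma quasi_pfister_mult:
  "u \<in> value_set (quasi_pfister xs) \<Longrightarrow> v \<in> value_set (quasi_pfister (xs :: 'b list)) \<Longrightarrow>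
    u * v \<in> value_set (quasi_pfister xs)"
proof (induction xs arbitrary: u v)
  case Nil
  have "value_set (quasi_pfister []) = range (\<lambda>c::'b. c\<^sup>2)"
    unfolding quasi_pfister_Nil value_set_eq_range
    by (auto simp: qf_val_def image_iff)
  then show ?case using Nil by (auto simp flip: power_mult_distrib)
next
  case (Cons y xs)
  let ?L = "value_set (quasi_pfister xs)"
  from Cons.prems obtain u1 u2 v1 v2 where
    *: "u = u1 + y * u2" "v = v1 + y * v2" "u1 \<in> ?L" "u2 \<in> ?L" "v1 \<in> ?L" "v2 \<in> ?L"
    unfolding value_set_quasi_pfister_Cons by blast
  have "u * v = (u1 * v1 + y\<^sup>2 * (u2 * v2)) + y * (u1 * v2 + u2 * v1)"
    by (simp add: * algebra_simps power2_eq_square)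
  moreover have "u1 * v1 + y\<^sup>2 * (u2 * v2) \<in> ?L" "u1 * v2 + u2 * v1 \<in> ?L"
    using * by (auto intro!: value_set_add value_set_square_mult Cons.IH)
  ultimately show ?case unfolding value_set_quasi_pfister_Cons by blast
qed

lemma quasi_pfister_inverse:
  assumes "u \<in> value_set (quasi_pfister (xs :: 'b list))"
  shows "inverse u \<in> value_set (quasi_pfister xs)"
proof -
  have "inverse u = (inverse u)\<^sup>2 * u" by (cases "u = 0") (simp_all add: power2_eq_square)
  then show ?thesis using value_set_square_mult[OF assms] by metis
qed

text \<open>The value set L of the shorter form is a field, so a common nonzero element of L and yL
  would put y into L.\<close>

lemma anisotropic_quasi_pfister_Cons:
  assumes p: "anisotropic (quasi_pfister xs)" and y: "y \<notin> value_set (quasi_pfister (xs :: 'b list))"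
  shows "anisotropic (quasi_pfister (y # xs))"
  unfolding quasi_pfister_Cons
proof (rule anisotropic_append)
  have "y \<noteq> 0" using y value_set_zero by metis
  then show "anisotropic (map ((*) y) (quasi_pfister xs))" by (rule anisotropic_map_mult[OF _ p])
  fix u assume u: "u \<in> value_set (quasi_pfister xs)"
    "u \<in> value_set (map ((*) y) (quasi_pfister xs))"
  then obtain v where v: "u = y * v" "v \<in> value_set (quasi_pfister xs)"
    by (auto simp: value_set_map_mult)
  show "u = 0"
  proof (rule ccontr)
    assume "u \<noteq> 0"
    then have "y = u * inverse v" using v by simp
    then show False using y quasi_pfister_mult[OF u(1) quasi_pfister_inverse[OF v(2)]] by simp
  qed
qed (rule p)

text \<open>Slots are chosen greedily: the value set of a form of dimension less than
  \<open>card S\<close> cannot contain the independent set \<open>S\<close>, so some element of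
  \<open>S\<close> lies outside it and serves as the next slot.\<close>

lemma ex_anisotropic_quasi_pfister:
  assumes S: "finite S" "sq.independent S"
    and j: "\<And>k. k < j \<Longrightarrow> 2 ^ k < card S"
  shows "\<exists>xs. length xs = j \<and> set xs \<subseteq> S \<and> anisotropic (quasi_pfister (xs :: 'b list))"
  using j
proof (induction j)
  case 0
  show ?case by (simp add: quasi_pfister_Nil anisotropic_iff_independent)
next
  case (Suc j)
  then obtain xs where xs: "length xs = j" "set xs \<subseteq> S" "anisotropic (quasi_pfister xs)"
    by (meson less_SucI)
  let ?p = "quasi_pfister xs"
  have "card (set ?p) < card S"
    using Suc.prems[of j] card_length[of ?p] xs(1) by (simp add: length_quasi_pfister)
  then have "\<not> S \<subseteq> value_set ?p"
    using sq.independent_span_bound[OF _ S(2), of "set ?p"] by (auto simp: value_set_eq_span)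
  then obtain y where "y \<in> S" "y \<notin> value_set ?p" by blast
  then have "length (y # xs) = Suc j \<and> set (y # xs) \<subseteq> S \<and> anisotropic (quasi_pfister (y # xs))"
    using xs anisotropic_quasi_pfister_Cons by simp
  then show ?case by blast
qed

section \<open>Tensor products and divisibility by a quasi-Pfister form\<close>

lemma quasi_pfister_mult_mem:
  assumes "\<And>y v. y \<in> set xs \<Longrightarrow> v \<in> value_set psi \<Longrightarrow> y * v \<in> value_set psi"
    and "l \<in> value_set (quasi_pfister xs)" "v \<in> value_set (psi :: 'b list)"
  shows "l * v \<in> value_set psi"
  using assms
proof (induction xs arbitrary: l v)
  case Nil
  then obtain c where "l = c\<^sup>2" by (auto simp: quasi_pfister_Nil value_set_eq_range qf_val_def)
  then show ?case using Nil value_set_square_mult by blast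
next
  case (Cons y xs)
  then obtain l1 l2 where l: "l = l1 + y * l2"
    "l1 \<in> value_set (quasi_pfister xs)" "l2 \<in> value_set (quasi_pfister xs)"
    unfolding value_set_quasi_pfister_Cons by blast
  \<comment> \<open>The elements stabilizing a value set contain the squares and are closed under
    sums and products, hence contain all that the slots generate.\<close>
  have "l1 * v \<in> value_set psi" "l2 * v \<in> value_set psi"
    using Cons.IH Cons.prems l by auto
  then have "l1 * v + y * (l2 * v) \<in> value_set psi"
    using Cons.prems(1) value_set_add by simp
  then show ?case by (simp add: l algebra_simps)
qed

text \<open>The two lists differ only in order, and neither anisotropy nor the value set depends on
  it.\<close>

lemma mset_qf_tensor_Cons: "mset (qf_tensor p (v # t)) = mset (map ((*) v) p @ qf_tensor p t)"
  for v :: 'b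
  by (induction p) (simp_all add: qf_tensor_def mult.commute)

lemma qf_tensor_Nil: "qf_tensor p [] = []"
  by (simp add: qf_tensor_def)

lemma value_set_qf_tensor_Cons:
  "value_set (qf_tensor p (v # t)) =
    {v * l + w | l w. l \<in> value_set p \<and> w \<in> value_set (qf_tensor p t)}" for v :: 'b
  by (auto simp: value_set_cong_mset[OF mset_qf_tensor_Cons] value_set_append value_set_map_mult)

lemma length_qf_tensor: "length (qf_tensor p t) = length p * length t"
  by (induction p) (simp_all add: qf_tensor_def)

lemma value_set_Nil: "value_set [] = {0}"
  by (auto simp: value_set_eq_range qf_val_def)

lemma quasi_pfister_mult_tensor:
  assumes "l \<in> value_set (quasi_pfister xs)"
    and "w \<in> value_set (qf_tensor (quasi_pfister xs) t)"
  shows "l * w \<in> value_set (qf_tensor (quasi_pfister xs) (t :: 'b list))"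
  using assms
proof (induction t arbitrary: w)
  case Nil
  then show ?case by (simp add: qf_tensor_Nil value_set_Nil)
next
  case (Cons v t)
  then obtain k u where w: "w = v * k + u" "k \<in> value_set (quasi_pfister xs)"
    "u \<in> value_set (qf_tensor (quasi_pfister xs) t)"
    by (auto simp: value_set_qf_tensor_Cons)
  have "l * w = v * (l * k) + l * u" by (simp add: w algebra_simps)
  then show ?case
    unfolding value_set_qf_tensor_Cons using quasi_pfister_mult w Cons by blast
qed

text \<open>The value set of \<open>psi\<close> is a vector space over the field L of values of the
  Pfister form. A list \<open>t\<close> of maximal length whose tensor product is anisotropic with
  values in that space is an L-basis: for a missed \<open>v\<close>, the line vL meets the span only
  in 0, so \<open>t\<close> could be extended by \<open>v\<close>.\<close>

lemma divisible_by_quasi_pfister: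
  assumes p: "anisotropic (quasi_pfister xs)" and psi: "anisotropic psi" "psi \<noteq> []"
    and stab: "\<And>y v. y \<in> set xs \<Longrightarrow> v \<in> value_set psi \<Longrightarrow> y * v \<in> value_set (psi :: 'b list)"
  shows "divisible_by psi (quasi_pfister xs)"
proof -
  let ?p = "quasi_pfister xs"
  define good where
    "good t \<longleftrightarrow> anisotropic (qf_tensor ?p t) \<and> value_set (qf_tensor ?p t) \<subseteq> value_set psi" for t
  have "length t \<le> length psi" if "good t" for t
  proof -
    have "length ?p * length t \<le> length psi"
      using that length_le_if_value_set_subset length_qf_tensor unfolding good_def by metis
    then show ?thesis
      by (simp add: length_quasi_pfister)
        (metis le_trans mult_le_mono1 mult_1 one_le_numeral one_le_power)
  qed
  moreover have "good []"
    by (simp add: good_def qf_tensor_Nil value_set_Nil value_set_zero anisotropic_iff_independent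
        sq.independent_empty)
  ultimately obtain t where t: "good t" and max: "\<And>t'. good t' \<Longrightarrow> length t' \<le> length t"
    using ex_has_greatest_nat[of good "[]" length "Suc (length psi)"]
    by (metis le_imp_less_Suc)
  have "value_set psi \<subseteq> value_set (qf_tensor ?p t)"
  proof (rule ccontr)
    assume "\<not> ?thesis"
    then obtain v where v: "v \<in> value_set psi" "v \<notin> value_set (qf_tensor ?p t)" by blast
    have vnz: "v \<noteq> 0" using v value_set_zero by metis
    have "anisotropic (map ((*) v) ?p @ qf_tensor ?p t)"
    proof (rule anisotropic_append)
      show "anisotropic (map ((*) v) ?p)" by (rule anisotropic_map_mult[OF vnz p])
      show "anisotropic (qf_tensor ?p t)" using t by (simp add: good_def)
      fix u assume u: "u \<in> value_set (map ((*) v) ?p)" "u \<in> value_set (qf_tensor ?p t)"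
      then obtain l where l: "u = v * l" "l \<in> value_set ?p" by (auto simp: value_set_map_mult)
      show "u = 0"
      proof (rule ccontr)
        assume "u \<noteq> 0"
        then have "v = inverse l * u" using l by simp
        then show False
          using v quasi_pfister_mult_tensor[OF quasi_pfister_inverse[OF l(2)] u(2)] by simp
      qed
    qed
    then have "anisotropic (qf_tensor ?p (v # t))"
      using anisotropic_cong_mset[OF mset_qf_tensor_Cons] by blast
    moreover have "value_set (qf_tensor ?p (v # t)) \<subseteq> value_set psi"
      unfolding value_set_qf_tensor_Cons
      using quasi_pfister_mult_mem[OF stab] v(1) t value_set_add
      by (auto simp: good_def mult.commute[of v])
    ultimately have "good (v # t)" by (simp add: good_def)
    then show False using max by fastforce
  qed
  then have eq: "value_set psi = value_set (qf_tensor ?p t)" using t by (auto simp: good_def)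
  have "isometric psi (qf_tensor ?p t)"
    using isometric_if_value_set_eq[OF psi(1) _ eq] t by (simp add: good_def)
  moreover from this have "t \<noteq> []" using psi(2) by (auto simp: isometric_def qf_tensor_Nil)
  ultimately show ?thesis unfolding divisible_by_def by blast
qed

end

subsection \<open>The stabilizer of the value set over the function field\<close>

lemma CHAR_2_two_eq_0: "CHAR('a::comm_ring_1) = 2 \<Longrightarrow> (2::'a) = 0"
  using of_nat_CHAR[where ?'a = 'a] by simp

lemma vector_space_mult: "vector_space ((*) :: 'a::field \<Rightarrow> 'a \<Rightarrow> 'a)"
  by unfold_locales (simp_all add: algebra_simps)

text \<open>The functional dual to the basis vector \<open>a ! i\<close>. Its target is K with
  ordinary multiplication, so that linearity becomes exactly the condition under which
  \<open>cartier\<close> takes square factors out as their roots.\<close>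

lemma (in char_two) ex_coordinate_functional:
  assumes a: "anisotropic (a :: 'b list)" and i: "i < length a"
  obtains f where "\<And>u v. f (u + v) = f u + f v" "\<And>c v. f (c\<^sup>2 * v) = c * f v"
    "\<And>j. j < length a \<Longrightarrow> f (a ! j) = (if j = i then 1 else 0)"
proof -
  interpret vector_space_pair "\<lambda>(c::'b) v. c\<^sup>2 * v" "(*) :: 'b \<Rightarrow> 'b \<Rightarrow> 'b"
    by (intro vector_space_pair.intro sq.vector_space_axioms vector_space_mult)
  have ind: "sq.independent (set a)" and dist: "distinct a"
    using a by (simp_all add: anisotropic_iff_independent)
  obtain f where f: "Vector_Spaces.linear (\<lambda>c v. c\<^sup>2 * v) (*) f"
    "\<forall>u\<in>set a. f u = (if u = a ! i then 1 else 0)"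
    using linear_independent_extend[OF ind, of "\<lambda>u. if u = a ! i then 1 else 0"] by blast
  interpret f: Vector_Spaces.linear "\<lambda>(c::'b) v. c\<^sup>2 * v" "(*) :: 'b \<Rightarrow> 'b \<Rightarrow> 'b" f by (rule f(1))
  show thesis
    by (rule that[of f])
      (use f(2) dist i in \<open>auto simp: f.add f.scale nth_eq_iff_index_eq\<close>)
qed

text \<open>The Cartier operator of the functional dual to \<open>a ! i\<close> sends the sum of the
  a_j Z_j^2 to Z_i, and a multiple of the square of \<open>qf_poly a\<close> to a multiple of
  \<open>qf_poly a\<close>.\<close>

lemma qf_poly_dvd_coordinates:
  fixes a :: "'a::field list"
  assumes two: "(2::'a) = 0" and a: "anisotropic a" and i: "i < length a"
    and sq: "qf_val (map mconst a) Z = (qf_poly a)\<^sup>2 * q"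
  shows "qf_poly a dvd Z i"
proof -
  interpret char_two "TYPE('a)" by unfold_locales (rule two)
  obtain f where f: "\<And>u v. f (u + v) = f u + f v" "\<And>c v. f (c\<^sup>2 * v) = c * f v"
    "\<And>j. j < length a \<Longrightarrow> f (a ! j) = (if j = i then 1 else 0)"
    using ex_coordinate_functional[OF a i] by blast
  have "cartier f (qf_val (map mconst a) Z) =
      (\<Sum>j<length a. cartier f ((Z j)\<^sup>2 * mconst (a ! j)))"
    by (simp add: qf_val_def cartier_sum[OF f(1,2)] mult.commute)
  also have "\<dots> = (\<Sum>j<length a. Z j * mconst (f (a ! j)))"
    by (simp add: cartier_square_mult[OF f(1,2) two] cartier_mconst[OF f(1,2)])
  also have "\<dots> = (\<Sum>j<length a. if j = i then Z i else 0)"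
    by (rule sum.cong) (auto simp: f(3) mconst.one mconst.zero)
  also have "\<dots> = Z i" using i by simp
  finally have "Z i = qf_poly a * cartier f q"
    by (simp add: sq cartier_square_mult[OF f(1,2) two])
  then show ?thesis by simp
qed

text \<open>The two cross terms cancel.\<close>

lemma coeff_power2_char_two:
  assumes "(2::'b::comm_ring_1) = 0"
  shows "coeff (p\<^sup>2) 2 = (coeff p 1 :: 'b)\<^sup>2"
proof -
  have "coeff (p\<^sup>2) 2 = coeff p 0 * coeff p 2 + coeff p 1 * coeff p 1 + coeff p 2 * coeff p 0"
    by (simp add: power2_eq_square coeff_mult numeral_2_eq_2)
  also have "\<dots> = 2 * (coeff p 0 * coeff p 2) + (coeff p 1)\<^sup>2"
    by (simp add: power2_eq_square algebra_simps)
  finally show ?thesis using assms by simp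
qed

text \<open>The list \<open>[:x i, y i:]\<close> is the point x + t y of a line, which is x at t =
  0.\<close>

lemma (in coeff_hom) poly_mpoly_eval_0:
  fixes x :: "nat \<Rightarrow> 'b" and y :: "nat \<Rightarrow> 'b"
  shows "poly (mpoly_eval (\<lambda>c. [:h c:]) (\<lambda>i. [:x i, y i:]) p) 0 = mpoly_eval h x p"
  by (simp add: mpoly_eval_def poly_sum poly_prod poly_power)

section \<open>The generic point of the quadric and the stabilizer\<close>

locale quadric_function_field = coeff_hom h + char_two "TYPE('b)"
  for h :: "'a::field \<Rightarrow> 'b::field" +
  fixes a :: "'a list" and x :: "nat \<Rightarrow> 'b"
  assumes two: "(2::'a) = 0"
    and aniso: "anisotropic a"
    and x: "x \<in> vec_space (length a)"
    and x_isotropic: "qf_val (map h a) x = 0"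
    and dvd_if_vanishes:
      "\<And>p. poly_in_vars (length a) p \<Longrightarrow> mpoly_eval h x p = 0 \<Longrightarrow> qf_poly a dvd p"
    and ex_fraction: "\<And>z. \<exists>p q. mpoly_eval h x q \<noteq> 0 \<and> z = mpoly_eval h x p / mpoly_eval h x q"
begin

abbreviation ev where "ev \<equiv> mpoly_eval h x"

abbreviation tr :: "((nat \<Rightarrow>\<^sub>0 nat) \<Rightarrow>\<^sub>0 'a) \<Rightarrow> (nat \<Rightarrow>\<^sub>0 nat) \<Rightarrow>\<^sub>0 'a" where
  "tr \<equiv> truncate (length a)"

lemma dvd_truncate_if_vanishes: "ev p = 0 \<Longrightarrow> qf_poly a dvd tr p"
  using dvd_if_vanishes poly_in_vars_truncate mpoly_eval_truncate[OF x] by metis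

lemma ev_qf_poly: "ev (qf_poly a) = 0"
  by (simp add: mpoly_eval_qf_poly x_isotropic)

lemma ex_common_denominator:
  assumes "finite A"
  shows "\<exists>d P. ev d \<noteq> 0 \<and> (\<forall>i\<in>A. ev (P i) = ev d * f i)"
  using assms
proof induction
  case empty
  show ?case by (rule exI[of _ 1]) (simp add: coeff_hom.one[OF coeff_hom_mpoly_eval])
next
  case (insert j A)
  then obtain d P where d: "ev d \<noteq> 0" "\<forall>i\<in>A. ev (P i) = ev d * f i" by blast
  obtain p q where q: "ev q \<noteq> 0" "f j = ev p / ev q" using ex_fraction by blast
  show ?case
    by (rule exI[of _ "d * q"], rule exI[of _ "\<lambda>i. if i = j then d * p else q * P i"])
      (use d q insert(2) in \<open>auto simp: mpoly_eval_mult\<close>)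
qed

text \<open>The stabilized set is a span, so the generators \<open>h (a ! j)\<close> suffice. For
  these the identity for \<open>Y\<close> is evaluated on the line through \<open>x\<close> in the
  j-th coordinate direction.\<close>

lemma stabilizer:
  assumes Y: "qf_val (map mconst a) Y = qf_poly a * q"
    and v: "v \<in> value_set (map h a)"
  shows "ev q * v \<in> value_set (map h a)"
proof -
  let ?V = "value_set (map h a)"
  have gen: "ev q * h (a ! j) \<in> ?V" if j: "j < length a" for j
  proof -
    define k where "k c = [:h c:]" for c
    \<comment> \<open>The point x + t e_j over the polynomial ring in t; partial derivatives appear
      as coefficients of t.\<close>
    define X where "X i = [:x i, if i = j then 1 else 0:]" for i
    have sum_const_poly: "(\<Sum>i<m. [:g i:]) = [:\<Sum>i<m. g i:]" for g :: "nat \<Rightarrow> 'b" and m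
      by (induction m) simp_all
    interpret k: coeff_hom k by unfold_locales (simp_all add: k_def add mult one)
    let ?E = "mpoly_eval k X"
    have sq: "(X i)\<^sup>2 = [:(x i)\<^sup>2:] + (if i = j then monom 1 2 else 0)" for i
      using two_eq_0
      by (simp add: X_def power2_eq_square monom_altdef numeral_2_eq_2 algebra_simps flip: mult_2)
    \<comment> \<open>Since \<open>x\<close> is isotropic, the form takes the value a_j t^2 on this
      line.\<close>
    have "qf_val (map k a) X =
        (\<Sum>i<length a. [:h (a ! i) * (x i)\<^sup>2:] + (if i = j then monom (h (a ! j)) 2 else 0))"
      unfolding qf_val_def by (rule sum.cong) (auto simp: sq k_def distrib_left smult_monom)
    also have "\<dots> = [:qf_val (map h a) x:] + monom (h (a ! j)) 2"
      using j sum_const_poly[of "\<lambda>i. h (a ! i) * (x i)\<^sup>2" "length a"]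
      by (simp add: sum.distrib qf_val_def)
    finally have X: "qf_val (map k a) X = monom (h (a ! j)) 2" by (simp add: x_isotropic)
    \<comment> \<open>The t^2-coefficient is computed twice: from the form it is a value of the
      form, from the factorization it is a_j times the value of \<open>q\<close> at
      \<open>x\<close>.\<close>
    have "coeff (qf_val (map k a) (\<lambda>i. ?E (Y i))) 2 = qf_val (map h a) (\<lambda>i. coeff (?E (Y i)) 1)"
      by (simp add: qf_val_def k_def coeff_sum coeff_power2_char_two[OF two_eq_0])
    moreover have "qf_val (map k a) (\<lambda>i. ?E (Y i)) = monom (h (a ! j)) 2 * ?E q"
      using arg_cong[OF Y, of ?E]
      by (simp add: k.mpoly_eval_qf_val k.mpoly_eval_mult k.mpoly_eval_qf_poly X)
    moreover have "coeff (?E q) 0 = ev q"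
      using poly_mpoly_eval_0[of x "\<lambda>i. if i = j then 1 else 0" q]
      by (simp add: poly_0_coeff_0 k_def[abs_def] X_def[abs_def])
    ultimately have "h (a ! j) * ev q = qf_val (map h a) (\<lambda>i. coeff (?E (Y i)) 1)"
      by (simp add: coeff_monom_mult)
    then show ?thesis by (simp add: value_set_eq_range mult.commute)
  qed
  from v obtain c where "v = qf_val (map h a) c" by (auto simp: value_set_eq_range)
  then have "ev q * v = (\<Sum>j<length a. (c j)\<^sup>2 * (ev q * h (a ! j)))"
    by (simp add: qf_val_def sum_distrib_left ac_simps)
  also have "\<dots> \<in> sq.span (set (map h a))"
    using gen by (intro sq.span_sum sq.span_scale) (simp add: value_set_eq_span)
  finally show ?thesis by (simp add: value_set_eq_span)
qed

text \<open>After clearing denominators the form of the numerators vanishes at the generic point, so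
  \<open>qf_poly a\<close> divides its truncation.\<close>

lemma ex_polynomial_lift:
  assumes w: "qf_val (map h a) w = 0"
  shows "\<exists>d Y q. d \<noteq> 0 \<and> (\<forall>i<length a. ev (Y i) = d * w i) \<and>
    qf_val (map mconst a) Y = qf_poly a * q"
proof -
  obtain d P where d: "ev d \<noteq> 0" and P: "\<forall>i\<in>{..<length a}. ev (P i) = ev d * w i"
    using ex_common_denominator[of "{..<length a}" w] by blast
  have "ev (qf_val (map mconst a) P) = qf_val (map h a) (\<lambda>i. ev d * w i)"
    unfolding mpoly_eval_qf_val by (rule qf_val_cong) (use P in simp)
  then have "ev (qf_val (map mconst a) P) = 0"
    using w by (simp add: qf_val_scale)
  then have "qf_poly a dvd tr (qf_val (map mconst a) P)" by (rule dvd_truncate_if_vanishes)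
  then obtain q where "qf_val (map mconst a) (\<lambda>i. tr (P i)) = qf_poly a * q"
    unfolding truncate_qf_val by (elim dvdE)
  moreover have "\<forall>i<length a. ev (tr (P i)) = ev d * w i"
    using P by (simp add: mpoly_eval_truncate[OF x])
  ultimately have "ev d \<noteq> 0 \<and> (\<forall>i<length a. ev (tr (P i)) = ev d * w i) \<and>
      qf_val (map mconst a) (\<lambda>i. tr (P i)) = qf_poly a * q"
    using d by simp
  then show ?thesis by (intro exI)
qed

text \<open>This is injectivity of the semilinear map from isotropic vectors to the stabilizer,
  stated on linear combinations: the same combination \<open>Z\<close> of the lifts has quotient
  \<open>q0\<close>, and if \<open>q0\<close> vanishes at \<open>x\<close>, then so does
  \<open>Z\<close>.\<close>

lemma stabilizer_independent:
  assumes B: "finite B"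
    and Y: "\<And>w. w \<in> B \<Longrightarrow> qf_val (map mconst a) (Y w) = qf_poly a * q w"
    and rel: "(\<Sum>w\<in>B. (c w)\<^sup>2 * ev (q w)) = 0" and i: "i < length a"
  shows "(\<Sum>w\<in>B. c w * ev (Y w i)) = 0"
proof -
  have two': "(2 :: (nat \<Rightarrow>\<^sub>0 nat) \<Rightarrow>\<^sub>0 'a) = 0" by (rule mconst.two_eq_0[OF two])
  obtain d C where d: "ev d \<noteq> 0" and C: "\<forall>w\<in>B. ev (C w) = ev d * c w"
    using ex_common_denominator[OF B, of c] by blast
  define q0 where "q0 = (\<Sum>w\<in>B. (C w)\<^sup>2 * q w)"
  define Z where "Z i = (\<Sum>w\<in>B. C w * Y w i)" for i
  have "ev q0 = (\<Sum>w\<in>B. (ev d)\<^sup>2 * ((c w)\<^sup>2 * ev (q w)))"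
    unfolding q0_def mpoly_eval_sum
  proof (rule sum.cong[OF refl])
    fix w assume "w \<in> B"
    then have "ev (C w) = ev d * c w" using C by blast
    then show "ev ((C w)\<^sup>2 * q w) = (ev d)\<^sup>2 * ((c w)\<^sup>2 * ev (q w))"
      by (simp only: mpoly_eval_mult mpoly_eval_power power_mult_distrib mult.assoc)
  qed
  also have "\<dots> = 0" by (simp only: rel mult_zero_right flip: sum_distrib_left)
  finally have "qf_poly a dvd tr q0" by (rule dvd_truncate_if_vanishes)
  then obtain q1 where q1: "tr q0 = qf_poly a * q1" by (elim dvdE)
  have "qf_val (map mconst a) Z = (\<Sum>w\<in>B. (C w)\<^sup>2 * qf_val (map mconst a) (Y w))"
    unfolding Z_def by (simp add: qf_val_sum[OF two'] qf_val_scale)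
  also have "\<dots> = qf_poly a * q0"
    by (simp add: q0_def sum_distrib_left Y mult.left_commute)
  finally have "tr (qf_val (map mconst a) Z) = qf_poly a * tr q0"
    by (simp add: truncate.mult truncate_qf_poly)
  \<comment> \<open>The second factor \<open>qf_poly a\<close> comes from \<open>q0\<close>; a
    square factor is what the Cartier argument requires.\<close>
  then have "qf_val (map mconst a) (\<lambda>i. tr (Z i)) = (qf_poly a)\<^sup>2 * q1"
    by (simp add: truncate_qf_val q1 power2_eq_square mult.assoc)
  from qf_poly_dvd_coordinates[OF two aniso i this]
  obtain s where "tr (Z i) = qf_poly a * s" by (elim dvdE)
  then have "ev (tr (Z i)) = 0" by (simp add: mpoly_eval_mult ev_qf_poly)
  then have "ev (Z i) = 0" by (simp add: mpoly_eval_truncate[OF x])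
  moreover have "ev (Z i) = (\<Sum>w\<in>B. ev d * (c w * ev (Y w i)))"
    unfolding Z_def mpoly_eval_sum
    using C by (intro sum.cong refl) (simp only: mpoly_eval_mult mult.assoc)
  ultimately show ?thesis using d by (simp flip: sum_distrib_left)
qed

text \<open>The set \<open>S\<close> consists of the values at \<open>x\<close> of the quotients
  attached to polynomial lifts of the vectors in \<open>B\<close>. Rescaling each vector by its
  nonzero denominator does not affect independence.\<close>

lemma ex_independent_in_stabilizer:
  assumes BU: "B \<subseteq> {v \<in> vec_space (length a). qf_val (map h a) v = 0}" and B: "lin_indep B"
  obtains S where "finite S" "card S = card B" "sq.independent S"
    "\<And>s v. s \<in> S \<Longrightarrow> v \<in> value_set (map h a) \<Longrightarrow> s * v \<in> value_set (map h a)"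
proof -
  have fin: "finite B" using B by (simp add: lin_indep_def)
  have "\<forall>w\<in>B. \<exists>d Y q. d \<noteq> 0 \<and> (\<forall>i<length a. ev (Y i) = d * w i) \<and>
      qf_val (map mconst a) Y = qf_poly a * q"
    using ex_polynomial_lift BU by blast
  then obtain d Y q where d: "\<And>w. w \<in> B \<Longrightarrow> d w \<noteq> 0"
    and Yw: "\<And>w i. w \<in> B \<Longrightarrow> i < length a \<Longrightarrow> ev (Y w i) = d w * w i"
    and Y: "\<And>w. w \<in> B \<Longrightarrow> qf_val (map mconst a) (Y w) = qf_poly a * q w"
    by metis
  have coeffs: "c w = 0" if rel: "(\<Sum>w\<in>B. (c w)\<^sup>2 * ev (q w)) = 0" and w: "w \<in> B" for c w
  proof -
    have "(\<Sum>w\<in>B. (c w * d w) * w i) = 0" for i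
    proof (cases "i < length a")
      case True
      have "(\<Sum>w\<in>B. (c w * d w) * w i) = (\<Sum>w\<in>B. c w * ev (Y w i))"
        by (rule sum.cong) (simp_all add: Yw True mult.assoc)
      then show ?thesis using stabilizer_independent[OF fin Y rel True] by simp
    next
      case False
      then show ?thesis using BU by (intro sum.neutral) (auto simp: vec_space_def)
    qed
    then have "c w * d w = 0"
      using B w unfolding lin_indep_def by (elim conjE allE[of _ "\<lambda>w. c w * d w"]) simp
    then show ?thesis using d[OF w] by simp
  qed
  let ?r = "\<lambda>w. ev (q w)"
  have inj: "inj_on ?r B"
  proof (rule inj_onI, rule ccontr)
    fix u v assume uv: "u \<in> B" "v \<in> B" "?r u = ?r v" "u \<noteq> v"
    \<comment> \<open>Two vectors with the same image would give a nontrivial relation, since the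
      image added to itself is 0.\<close>
    let ?c = "\<lambda>w. if w \<in> {u, v} then 1 else 0 :: 'b"
    have "(\<Sum>w\<in>B. (?c w)\<^sup>2 * ?r w) = (\<Sum>w\<in>{u, v}. ?r w)"
      using uv fin by (intro sum.mono_neutral_cong_right) auto
    also have "\<dots> = 0" using uv by (simp add: add_self)
    finally have "?c u = 0" by (rule coeffs) (rule uv)
    then show False by simp
  qed
  show thesis
  proof (rule that[of "?r ` B"])
    show "finite (?r ` B)" using fin by simp
    show "card (?r ` B) = card B" by (rule card_image[OF inj])
    show "sq.independent (?r ` B)"
    proof (rule sq.independent_if_scalars_zero)
      show "finite (?r ` B)" using fin by simp
      fix f s assume "(\<Sum>s\<in>?r ` B. (f s)\<^sup>2 * s) = 0" and s: "s \<in> ?r ` B"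
      then have "(\<Sum>w\<in>B. (f (?r w))\<^sup>2 * ?r w) = 0" by (simp add: sum.reindex[OF inj])
      then show "f s = 0" using coeffs[of "\<lambda>w. f (?r w)"] s by auto
    qed
    show "s * v \<in> value_set (map h a)" if "s \<in> ?r ` B" "v \<in> value_set (map h a)" for s v
      using that stabilizer[OF Y] by auto
  qed
qed

section \<open>The isotropy index as the size of an independent family\<close>

lemma ex_nonzero_value:
  assumes a: "a \<noteq> []"
  shows "\<exists>v\<in>value_set (map h a). v \<noteq> 0"
proof -
  interpret F: char_two "TYPE('a)" by unfold_locales (rule two)
  have "h (hd a) \<in> value_set (map h a)"
    using a by (simp add: value_set_eq_span sq.span_base)
  moreover have "hd a \<noteq> 0"
    using aniso hd_in_set[OF a] F.sq.dependent_zero[of "set a"]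
    by (auto simp: F.anisotropic_iff_independent)
  \<comment> \<open>The image of the inverse is an inverse of the image.\<close>
  then have "h (hd a) \<noteq> 0"
    using mult[of "hd a" "inverse (hd a)"] by (auto simp: one)
  ultimately show ?thesis by blast
qed

text \<open>For a nonzero value \<open>v\<close>, multiplication by \<open>v\<close> embeds the
  independent set \<open>S\<close> into the value set, whose dimension is at most
  \<open>length a\<close>.\<close>

lemma card_isotropic_le:
  assumes a: "a \<noteq> []"
    and BU: "B \<subseteq> {v \<in> vec_space (length a). qf_val (map h a) v = 0}" and B: "lin_indep B"
  shows "card B \<le> length a"
proof -
  obtain S where S: "finite S" "card S = card B" "sq.independent S"
    "\<And>s v. s \<in> S \<Longrightarrow> v \<in> value_set (map h a) \<Longrightarrow> s * v \<in> value_set (map h a)"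
    using ex_independent_in_stabilizer[OF BU B] by blast
  obtain v where v: "v \<in> value_set (map h a)" and "v \<noteq> 0"
    using ex_nonzero_value[OF a] by blast
  have "S \<subseteq> sq.span (set (map ((*) (inverse v)) (map h a)))"
  proof
    fix s assume "s \<in> S"
    then have "s * v \<in> value_set (map h a)" using S(4) v by blast
    moreover have "s = inverse v * (s * v)" using \<open>v \<noteq> 0\<close> by simp
    ultimately have "s \<in> value_set (map ((*) (inverse v)) (map h a))"
      unfolding value_set_map_mult by (rule rev_image_eqI)
    then show "s \<in> sq.span (set (map ((*) (inverse v)) (map h a)))"
      by (simp only: value_set_eq_span)
  qed
  then have "card S \<le> card (set (map ((*) (inverse v)) (map h a)))"
    using sq.independent_span_bound[OF _ S(3)] by blast
  also have "\<dots> \<le> length a"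
    using card_length[of "map ((*) (inverse v)) (map h a)"] by simp
  finally show ?thesis using S(2) by simp
qed

text \<open>The maximum defining the dimension is attained: the cardinalities are bounded by
  \<open>length a\<close>, and the empty family supplies one.\<close>

lemma ex_isotropic_basis:
  assumes a: "a \<noteq> []"
  obtains B where "B \<subseteq> {v \<in> vec_space (length a). qf_val (map h a) v = 0}" "lin_indep B"
    "card B = isotropy_index (map h a)"
proof -
  let ?U = "{v \<in> vec_space (length a). qf_val (map h a) v = 0}"
  let ?M = "{card B | B. B \<subseteq> ?U \<and> lin_indep B}"
  have "finite ?M"
    by (rule finite_subset[of _ "{..length a}"]) (use card_isotropic_le[OF a] in auto)
  moreover have "lin_indep ({} :: (nat \<Rightarrow> 'b) set)" by (simp add: lin_indep_def)
  then have "?M \<noteq> {}" by blast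
  ultimately have "Max ?M \<in> ?M" by (rule Max_in)
  then show thesis using that unfolding isotropy_index_def subspace_dim_def by auto
qed

end

theorem mainTheorem2:
  fixes a :: "'a::field list"
    and \<iota> :: "'a \<Rightarrow> 'b::field"
    and x :: "nat \<Rightarrow> 'b"
    and psi :: "'b list"
  assumes "CHAR('a) = 2"
    and "length a \<ge> 2"
    and "anisotropic a"
    and "is_function_field a \<iota> x"
    and "anisotropic psi"
    and "value_set psi = value_set (map \<iota> a)"
  shows "\<exists>p. is_quasi_pfister (LEAST s. (2::nat) ^ s \<ge> isotropy_index (map \<iota> a)) p
             \<and> divisible_by psi p"
proof -
  have two: "(2::'a) = 0" by (rule CHAR_2_two_eq_0[OF assms(1)])
  interpret coeff_hom \<iota>
    using assms(4) unfolding is_function_field_def by unfold_locales auto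
  interpret char_two "TYPE('b)" by unfold_locales (rule two_eq_0[OF two])
  interpret quadric_function_field \<iota> a x
    by unfold_locales
      (use assms(3,4) two in \<open>unfold is_function_field_def, blast+\<close>)
  have "a \<noteq> []" using assms(2) by auto
  then obtain B where B: "B \<subseteq> {v \<in> vec_space (length a). qf_val (map \<iota> a) v = 0}" "lin_indep B"
    "card B = isotropy_index (map \<iota> a)"
    by (rule ex_isotropic_basis)
  obtain S where S: "finite S" "card S = card B" "sq.independent S"
    "\<And>s v. s \<in> S \<Longrightarrow> v \<in> value_set (map \<iota> a) \<Longrightarrow> s * v \<in> value_set (map \<iota> a)"
    using ex_independent_in_stabilizer[OF B(1,2)] by blast
  let ?s = "LEAST s. (2::nat) ^ s \<ge> isotropy_index (map \<iota> a)"
  \<comment> \<open>Minimality of the exponent is exactly what allows a new slot at each of the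
    \<open>?s\<close> greedy steps.\<close>
  have "2 ^ k < card S" if "k < ?s" for k
    using not_less_Least[OF that] S(2) B(3) by simp
  then obtain xs where xs: "length xs = ?s" "set xs \<subseteq> S" "anisotropic (quasi_pfister xs)"
    using ex_anisotropic_quasi_pfister[OF S(1,3)] by blast
  \<comment> \<open>The slots of a quasi-Pfister form must be nonzero, and they are taken from
    \<open>S\<close>.\<close>
  have "0 \<notin> S" using S(3) sq.dependent_zero by blast
  then have "is_quasi_pfister ?s (quasi_pfister xs)"
    using xs(1,2) unfolding is_quasi_pfister_def by blast
  moreover have "psi \<noteq> []"
    using ex_nonzero_value[OF \<open>a \<noteq> []\<close>] assms(6) by (auto simp: value_set_Nil)
  then have "divisible_by psi (quasi_pfister xs)"
    using xs(2) S(4) assms(6) by (intro divisible_by_quasi_pfister[OF xs(3) assms(5)]) auto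
  ultimately show ?thesis by blast
qed

end
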